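(* Let $L>0$ and let $\mathcal A$ be the class of admissible functions on $[0,L]$. If a sequence $(A_n)_{n\ge1}\subset\mathcal A$ converges very weakly to $A\in\mathcal A$, then the sequence of unbounded operators $(T_{A_n})_{n\ge1}$ converges in the gap topology to the unbounded operator $T_A$.
   Context: $\boldsymbol H=L^2([0,L],\mathbb C)$. A function $A:[0,L]\to\mathbb R$ is admissible ($A\in\mathcal A$) if it has bounded variation, is right continuous and $A(0)=0$. A sequence $A_n\in\mathcal A$ converges very weakly to $A\in\mathcal A$ if there is a Lebesgue-negligible set $\Delta\subset(0,L)$ with $\lim_nA_n(t)=A(t)$ for all $t\in[0,L]\setminus\Delta$ (in particular at $t=L$). For $A\in\mathcal A$ let $\Phi_A(t)=iA(t)-t$ and let $R_A$ be the bounded (compact, injective) operator on $\boldsymbol H$ $$(R_Af)(t)=\frac{i\,e^{-\Phi_A(t)}}{e^{\Phi_A(L)}-1}\int_0^Le^{\Phi_A(s)}f(s)\,ds+i\int_0^te^{-(\Phi_A(t)-\Phi_A(s))}f(s)\,ds .$$ Then $T_A:=R_A^{-1}-i$, a closed, densely defined (selfadjoint) operator on $\boldsymbol H$ with domain $\mathrm{Range}(R_A)$; so $R_A=(i+T_A)^{-1}$. Convergence of closed operators in the gap topology means convergence in operator norm of the orthogonal projections onto their graphs in $\boldsymbol H\oplus\boldsymbol H$; for selfadjoint operators it is equivalent to norm convergence of the resolvents $(i+T)^{-1}$. *)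

theory Defs
  imports "HOL-Analysis.Analysis"
begin

text \<open>The elements of \<open>L\<^sup>2(M, \<complex>)\<close> are represented by square-integrable functions, with equality in
  \<open>L\<^sup>2(M, \<complex>)\<close> being equality almost everywhere.\<close>

definition L2 :: "'a measure \<Rightarrow> ('a \<Rightarrow> complex) set" where
  "L2 M = {f. f \<in> borel_measurable M \<and> integrable M (\<lambda>x. (cmod (f x))\<^sup>2)}"

definition L2_inner :: "'a measure \<Rightarrow> ('a \<Rightarrow> complex) \<Rightarrow> ('a \<Rightarrow> complex) \<Rightarrow> complex" where
  "L2_inner M f g = (LINT x|M. f x * cnj (g x))"

type_synonym 'a fun_pair = "('a \<Rightarrow> complex) \<times> ('a \<Rightarrow> complex)"

definition pair_minus :: "'a fun_pair \<Rightarrow> 'a fun_pair \<Rightarrow> 'a fun_pair" where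
  "pair_minus p q = ((\<lambda>x. fst p x - fst q x), (\<lambda>x. snd p x - snd q x))"

text \<open>Inner product and norm of the Hilbert space direct sum \<open>L\<^sup>2(M) \<oplus> L\<^sup>2(M)\<close>.\<close>

definition sum_inner :: "'a measure \<Rightarrow> 'a fun_pair \<Rightarrow> 'a fun_pair \<Rightarrow> complex" where
  "sum_inner M p q = L2_inner M (fst p) (fst q) + L2_inner M (snd p) (snd q)"

definition sum_norm :: "'a measure \<Rightarrow> 'a fun_pair \<Rightarrow> real" where
  "sum_norm M p = sqrt (Re (sum_inner M p p))"

text \<open>Operator norm of a map on \<open>L\<^sup>2(M) \<oplus> L\<^sup>2(M)\<close>; it is \<open>\<infinity>\<close> if the map is unbounded.\<close>

definition sum_opnorm :: "'a measure \<Rightarrow> ('a fun_pair \<Rightarrow> 'a fun_pair) \<Rightarrow> ennreal" where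
  "sum_opnorm M D = (SUP p \<in> {p \<in> L2 M \<times> L2 M. sum_norm M p \<le> 1}. ennreal (sum_norm M (D p)))"

text \<open>The orthogonal projection onto \<open>G\<close> is determined up to equality almost everywhere. For a linear
  subspace \<open>G\<close> that is saturated under equality almost everywhere, its existence forces \<open>G\<close> to be
  closed.\<close>

definition is_orth_proj :: "'a measure \<Rightarrow> 'a fun_pair set \<Rightarrow> ('a fun_pair \<Rightarrow> 'a fun_pair) \<Rightarrow> bool" where
  "is_orth_proj M G P \<longleftrightarrow>
     (\<forall>p \<in> L2 M \<times> L2 M. P p \<in> G \<and> (\<forall>g \<in> G. sum_inner M (pair_minus p (P p)) g = 0))"

text \<open>Gap convergence of operators on \<open>L\<^sup>2(M)\<close>, each given by its graph.\<close>

definition gap_converges :: "'a measure \<Rightarrow> (nat \<Rightarrow> 'a fun_pair set) \<Rightarrow> 'a fun_pair set \<Rightarrow> bool" where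
  "gap_converges M \<Gamma> G \<longleftrightarrow>
     (\<exists>P Q. (\<forall>n. is_orth_proj M (\<Gamma> n) (P n)) \<and> is_orth_proj M G Q \<and>
            (\<lambda>n. sum_opnorm M (\<lambda>p. pair_minus (P n p) (Q p))) \<longlonglongrightarrow> 0)"

definition bounded_variation_on :: "real \<Rightarrow> real \<Rightarrow> (real \<Rightarrow> real) \<Rightarrow> bool" where
  "bounded_variation_on a b A \<longleftrightarrow>
     (\<exists>B. \<forall>n (x :: nat \<Rightarrow> real). x ` {..n} \<subseteq> {a..b} \<and> mono_on {..n} x \<longrightarrow>
            (\<Sum>i<n. \<bar>A (x (Suc i)) - A (x i)\<bar>) \<le> B)"

text \<open>Functions on \<open>[0, L]\<close> are total functions whose values outside \<open>[0, L]\<close> are irrelevant.\<close>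

definition admissible :: "real \<Rightarrow> (real \<Rightarrow> real) \<Rightarrow> bool" where
  "admissible L A \<longleftrightarrow>
     bounded_variation_on 0 L A \<and> (\<forall>t \<in> {0..<L}. continuous (at_right t) A) \<and> A 0 = 0"

definition very_weakly_converges :: "real \<Rightarrow> (nat \<Rightarrow> real \<Rightarrow> real) \<Rightarrow> (real \<Rightarrow> real) \<Rightarrow> bool" where
  "very_weakly_converges L An A \<longleftrightarrow>
     (\<exists>\<Delta>. \<Delta> \<subseteq> {0<..<L} \<and> negligible \<Delta> \<and> (\<forall>t \<in> {0..L} - \<Delta>. (\<lambda>n. An n t) \<longlonglongrightarrow> A t))"

definition \<Phi> :: "(real \<Rightarrow> real) \<Rightarrow> real \<Rightarrow> complex" where
  "\<Phi> A t = \<i> * of_real (A t) - of_real t"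

definition R_op :: "real \<Rightarrow> (real \<Rightarrow> real) \<Rightarrow> (real \<Rightarrow> complex) \<Rightarrow> real \<Rightarrow> complex" where
  "R_op L A f t =
     \<i> * exp (- \<Phi> A t) / (exp (\<Phi> A L) - 1) * (LINT s:{0..L}|lebesgue. exp (\<Phi> A s) * f s)
     + \<i> * (LINT s:{0..t}|lebesgue. exp (- (\<Phi> A t - \<Phi> A s)) * f s)"

text \<open>The graph of \<open>T = R\<^sup>-\<^sup>1 - \<i>\<close>, where \<open>R\<close> is the operator above: the domain is the range of \<open>R\<close>,
  and \<open>T u = f - \<i> u\<close> for \<open>u = R f\<close>.\<close>

definition T_graph :: "real \<Rightarrow> (real \<Rightarrow> real) \<Rightarrow> real fun_pair set" where
  "T_graph L A =
     {(u, v). u \<in> L2 (lebesgue_on {0..L}) \<and> v \<in> L2 (lebesgue_on {0..L}) \<and>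
        (\<exists>f \<in> L2 (lebesgue_on {0..L}).
           (AE t in lebesgue_on {0..L}. u t = R_op L A f t) \<and>
           (AE t in lebesgue_on {0..L}. v t = f t - \<i> * u t))}"

end

theory Submission
  imports Defs
begin

text \<open>
  Put \<open>y = e\<^bsup>iA\<^esup> u\<close>. Then \<open>u = R\<^sub>A f\<close> says that \<open>y\<close> is absolutely continuous with
  \<open>y' = y + i e\<^bsup>iA\<^esup> f\<close> and \<open>y(L) = e\<^bsup>iA(L)\<^esup> y(0)\<close>: the twist moves all of \<open>A\<close> into a unimodular
  multiplier and a unimodular boundary condition. Two facts follow.

  First, \<open>T\<^sub>A\<close> is symmetric. Replacing the exponent \<open>iA(t) - t\<close> by \<open>iA(t) - \<sigma> t\<close> gives a family
  \<open>S\<^sub>\<sigma>\<close> with \<open>y' = \<sigma> y + i e\<^bsup>iA\<^esup> f\<close> and the same boundary condition, so \<open>S\<^sub>\<sigma>\<close> is the inverse of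
  \<open>T\<^sub>A + \<sigma> i\<close>. As \<open>y\<^sub>f\<close> times the conjugate of \<open>y\<^sub>g\<close> takes the same value at \<open>0\<close> and at \<open>L\<close>, integrating the
  derivative of this product gives one identity for all pairs of parameters (\<open>Green_identity\<close>). The
  pair \<open>(1, -1)\<close> says that \<open>S\<^sub>-\<^sub>1\<close> is the adjoint of \<open>R = S\<^sub>1\<close>; the pair \<open>(1, 1)\<close> says that
  \<open>V f = (R f, f - i R f)\<close> is an isometry onto the graph of \<open>T\<^sub>A\<close>. Hence the orthogonal projection onto
  the graph is \<open>V V\<^sup>*\<close>, which is written out with \<open>R\<close> and \<open>S\<^sub>-\<^sub>1\<close> alone (\<open>is_orth_proj_graph_proj\<close>).

  Second, \<open>S\<^sub>1\<close> and \<open>S\<^sub>-\<^sub>1\<close> are integral operators whose kernels depend on \<open>A\<close> only through the values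
  \<open>A(t)\<close>, \<open>A(s)\<close>, \<open>A(L)\<close>, and only through numbers of modulus one. So the kernels are bounded uniformly
  in \<open>A\<close>, and very weak convergence makes them converge almost everywhere. By dominated convergence
  they converge in the Hilbert-Schmidt norm (\<open>HS_sqnorm_tendsto_0\<close>), hence so do the operators in
  norm, and so do the projections \<open>V V\<^sup>*\<close> (\<open>graph_proj_diff_le\<close>).
\<close>

section \<open>Square-integrable functions\<close>

text \<open>The square of the norm is used throughout: the parallelogram-type bound
  \<open>\<parallel>f + g\<parallel>\<^sup>2 \<le> 2\<parallel>f\<parallel>\<^sup>2 + 2\<parallel>g\<parallel>\<^sup>2\<close> then replaces the triangle inequality, at the price of constants that
  do not matter for a limit.\<close>

definition sqnorm :: "'a measure \<Rightarrow> ('a \<Rightarrow> complex) \<Rightarrow> real" where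
  "sqnorm M f = (LINT x|M. (cmod (f x))\<^sup>2)"

lemma sqnorm_nonneg: "0 \<le> sqnorm M f"
  by (simp add: sqnorm_def)

lemma L2_measurable: "f \<in> L2 M \<Longrightarrow> f \<in> borel_measurable M"
  by (simp add: L2_def)

lemma L2_cmult:
  assumes "f \<in> L2 M"
  shows "(\<lambda>x. c * f x) \<in> L2 M"
  using assms by (auto simp: L2_def norm_mult power_mult_distrib)

lemma sqnorm_cmult: "sqnorm M (\<lambda>x. c * f x) = (cmod c)\<^sup>2 * sqnorm M f"
  by (simp add: sqnorm_def norm_mult power_mult_distrib)

lemma cmod_add_square_le: "(cmod (a + b))\<^sup>2 \<le> 2 * (cmod a)\<^sup>2 + 2 * (cmod b)\<^sup>2"
proof -
  have "(cmod (a + b))\<^sup>2 \<le> (cmod a + cmod b)\<^sup>2"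
    by (intro power_mono norm_triangle_ineq) simp
  also have "\<dots> \<le> 2 * (cmod a)\<^sup>2 + 2 * (cmod b)\<^sup>2"
    using sum_squares_bound[of "cmod a" "cmod b"] by (simp add: power2_sum)
  finally show ?thesis .
qed

lemma
  assumes f: "f \<in> L2 M" and g: "g \<in> L2 M"
  shows L2_add: "(\<lambda>x. f x + g x) \<in> L2 M"
    and sqnorm_add_le: "sqnorm M (\<lambda>x. f x + g x) \<le> 2 * sqnorm M f + 2 * sqnorm M g"
proof -
  have [measurable]: "f \<in> borel_measurable M" "g \<in> borel_measurable M"
    using f g by (auto simp: L2_def)
  have int: "integrable M (\<lambda>x. 2 * (cmod (f x))\<^sup>2 + 2 * (cmod (g x))\<^sup>2)"
    using f g by (auto simp: L2_def)
  have "integrable M (\<lambda>x. (cmod (f x + g x))\<^sup>2)"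
    by (rule Bochner_Integration.integrable_bound[OF int]) (auto intro!: AE_I2 cmod_add_square_le)
  then show "(\<lambda>x. f x + g x) \<in> L2 M"
    by (simp add: L2_def)
  have "sqnorm M (\<lambda>x. f x + g x) \<le> (LINT x|M. 2 * (cmod (f x))\<^sup>2 + 2 * (cmod (g x))\<^sup>2)"
    unfolding sqnorm_def
    by (intro integral_mono int cmod_add_square_le) fact
  also have "\<dots> = 2 * sqnorm M f + 2 * sqnorm M g"
    using f g by (simp add: L2_def sqnorm_def)
  finally show "sqnorm M (\<lambda>x. f x + g x) \<le> 2 * sqnorm M f + 2 * sqnorm M g" .
qed

lemma
  assumes f: "f \<in> L2 M" and g: "g \<in> L2 M"
  shows L2_diff: "(\<lambda>x. f x - g x) \<in> L2 M"
    and sqnorm_diff_le: "sqnorm M (\<lambda>x. f x - g x) \<le> 2 * sqnorm M f + 2 * sqnorm M g"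
  using L2_add[OF f L2_cmult[OF g, of "-1"]] sqnorm_add_le[OF f L2_cmult[OF g, of "-1"]]
    sqnorm_cmult[of M "-1" g] by simp_all

lemma
  assumes f: "f \<in> L2 M" and g: "g \<in> L2 M"
  shows L2_mult_integrable: "integrable M (\<lambda>x. f x * g x)"
    and L2_Cauchy_Schwarz: "(cmod (LINT x|M. f x * g x))\<^sup>2 \<le> sqnorm M f * sqnorm M g"
proof -
  have [measurable]: "f \<in> borel_measurable M" "g \<in> borel_measurable M"
    using f g by (auto simp: L2_def)
  have int: "integrable M (\<lambda>x. (cmod (f x))\<^sup>2 + (cmod (g x))\<^sup>2)"
    using f g by (auto simp: L2_def)
  have bd: "cmod (f x * g x) \<le> (cmod (f x))\<^sup>2 + (cmod (g x))\<^sup>2" for x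
    using sum_squares_bound[of "cmod (f x)" "cmod (g x)"] mult_nonneg_nonneg[OF norm_ge_zero norm_ge_zero, of "f x" "g x"]
    unfolding norm_mult by linarith
  show fg: "integrable M (\<lambda>x. f x * g x)"
    by (rule Bochner_Integration.integrable_bound[OF int]) (use bd in \<open>auto intro!: AE_I2 order_trans[OF bd]\<close>)
  have sq: "(\<integral>\<^sup>+x. (ennreal (cmod (h x)))\<^sup>2 \<partial>M) = ennreal (sqnorm M h)" if "h \<in> L2 M" for h
    using that by (simp add: L2_def sqnorm_def ennreal_power nn_integral_eq_integral)
  have "ennreal ((cmod (LINT x|M. f x * g x))\<^sup>2) = (ennreal (cmod (LINT x|M. f x * g x)))\<^sup>2"
    by (simp add: ennreal_power)
  also have "\<dots> \<le> (\<integral>\<^sup>+x. ennreal (cmod (f x * g x)) \<partial>M)\<^sup>2"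
    by (intro power_mono integral_norm_bound_ennreal fg) simp
  also have "\<dots> = (\<integral>\<^sup>+x. ennreal (cmod (f x)) * ennreal (cmod (g x)) \<partial>M)\<^sup>2"
    by (simp add: norm_mult ennreal_mult)
  also have "\<dots> \<le> (\<integral>\<^sup>+x. (ennreal (cmod (f x)))\<^sup>2 \<partial>M) * (\<integral>\<^sup>+x. (ennreal (cmod (g x)))\<^sup>2 \<partial>M)"
    by (rule Cauchy_Schwarz_nn_integral) auto
  also have "\<dots> = ennreal (sqnorm M f * sqnorm M g)"
    by (simp add: sq f g ennreal_mult sqnorm_nonneg)
  finally show "(cmod (LINT x|M. f x * g x))\<^sup>2 \<le> sqnorm M f * sqnorm M g"
    by (simp add: ennreal_le_iff sqnorm_nonneg)
qed

lemma L2_cnj: "f \<in> L2 M \<Longrightarrow> (\<lambda>x. cnj (f x)) \<in> L2 M"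
  unfolding L2_def by (auto intro: measurable_compose[OF _ borel_measurable_continuous_onI[OF continuous_on_cnj[OF continuous_on_id]]])

lemma (in finite_measure) L2_bounded:
  assumes "f \<in> borel_measurable M" and "\<And>x. x \<in> space M \<Longrightarrow> cmod (f x) \<le> B"
  shows "f \<in> L2 M"
proof -
  have "(cmod (f x))\<^sup>2 \<le> B\<^sup>2" if "x \<in> space M" for x
    using assms(2)[OF that] by (intro power_mono) auto
  then have "integrable M (\<lambda>x. (cmod (f x))\<^sup>2)"
    using assms(1) by (intro integrable_const_bound[where B = "B\<^sup>2"]) (auto intro!: AE_I2)
  with assms(1) show ?thesis by (simp add: L2_def)
qed

lemma L2_inner_integrable:
  assumes "f \<in> L2 M" "g \<in> L2 M"
  shows "integrable M (\<lambda>x. f x * cnj (g x))"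
  by (rule L2_mult_integrable[OF assms(1) L2_cnj[OF assms(2)]])

lemma L2_inner_add_left:
  assumes "f \<in> L2 M" "g \<in> L2 M" "h \<in> L2 M"
  shows "L2_inner M (\<lambda>x. f x + g x) h = L2_inner M f h + L2_inner M g h"
  using assms by (simp add: L2_inner_def distrib_right L2_inner_integrable)

lemma L2_inner_diff_left:
  assumes "f \<in> L2 M" "g \<in> L2 M" "h \<in> L2 M"
  shows "L2_inner M (\<lambda>x. f x - g x) h = L2_inner M f h - L2_inner M g h"
  using assms by (simp add: L2_inner_def left_diff_distrib L2_inner_integrable)

lemma L2_inner_diff_right:
  assumes "f \<in> L2 M" "g \<in> L2 M" "h \<in> L2 M"
  shows "L2_inner M h (\<lambda>x. f x - g x) = L2_inner M h f - L2_inner M h g"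
  using assms by (simp add: L2_inner_def right_diff_distrib L2_inner_integrable)

lemma L2_inner_cmult_left: "L2_inner M (\<lambda>x. c * f x) h = c * L2_inner M f h"
  by (simp add: L2_inner_def mult.assoc)

lemma L2_inner_cmult_right: "L2_inner M h (\<lambda>x. c * f x) = cnj c * L2_inner M h f"
proof -
  have "L2_inner M h (\<lambda>x. c * f x) = (LINT x|M. cnj c * (h x * cnj (f x)))"
    by (simp add: L2_inner_def mult_ac)
  then show ?thesis by (simp add: L2_inner_def)
qed

lemma L2_inner_cong_AE_right:
  assumes "h \<in> L2 M" "f \<in> L2 M" "g \<in> L2 M" "AE x in M. f x = g x"
  shows "L2_inner M h f = L2_inner M h g"
  unfolding L2_inner_def
  by (rule integral_cong_AE)
     (use assms L2_inner_integrable[OF assms(1,2)] L2_inner_integrable[OF assms(1,3)] in auto)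

lemma sqnorm_cong: "(\<And>x. x \<in> space M \<Longrightarrow> f x = g x) \<Longrightarrow> sqnorm M f = sqnorm M g"
  by (simp add: sqnorm_def cong: Bochner_Integration.integral_cong)

lemma sum_norm_eq: "sum_norm M p = sqrt (sqnorm M (fst p) + sqnorm M (snd p))"
proof -
  have "L2_inner M f f = complex_of_real (sqnorm M f)" for f
    by (simp add: L2_inner_def sqnorm_def complex_norm_square[symmetric] flip: of_real_power)
  then show ?thesis by (simp add: sum_norm_def sum_inner_def)
qed

section \<open>Integral operators with bounded kernels\<close>

definition kernel_op :: "'a measure \<Rightarrow> ('a \<Rightarrow> 'a \<Rightarrow> complex) \<Rightarrow> ('a \<Rightarrow> complex) \<Rightarrow> 'a \<Rightarrow> complex" where
  "kernel_op M k f t = (LINT s|M. k t s * f s)"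

text \<open>The square of the Hilbert-Schmidt norm.\<close>

definition HS_sqnorm :: "'a measure \<Rightarrow> ('a \<Rightarrow> 'a \<Rightarrow> complex) \<Rightarrow> real" where
  "HS_sqnorm M k = (LINT t|M. sqnorm M (k t))"

definition bounded_kernel :: "'a measure \<Rightarrow> real \<Rightarrow> ('a \<Rightarrow> 'a \<Rightarrow> complex) \<Rightarrow> bool" where
  "bounded_kernel M C k \<longleftrightarrow>
     case_prod k \<in> borel_measurable (M \<Otimes>\<^sub>M M) \<and>
     (\<forall>t\<in>space M. \<forall>s\<in>space M. cmod (k t s) \<le> C)"

context finite_measure
begin

lemma bounded_kernel_section:
  assumes "bounded_kernel M C k" "t \<in> space M"
  shows "k t \<in> L2 M"
proof (rule L2_bounded)
  have [measurable]: "case_prod k \<in> borel_measurable (M \<Otimes>\<^sub>M M)"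
    using assms by (simp add: bounded_kernel_def)
  show "k t \<in> borel_measurable M"
    using assms(2) by measurable
  show "cmod (k t s) \<le> C" if "s \<in> space M" for s
    using assms that by (auto simp: bounded_kernel_def)
qed

lemma sqnorm_section_le:
  assumes "bounded_kernel M C k" "t \<in> space M"
  shows "sqnorm M (k t) \<le> C\<^sup>2 * measure M (space M)"
proof -
  have "(cmod (k t s))\<^sup>2 \<le> C\<^sup>2" if "s \<in> space M" for s
    using assms that by (intro power_mono) (auto simp: bounded_kernel_def)
  then have "sqnorm M (k t) \<le> (LINT s|M. C\<^sup>2)"
    unfolding sqnorm_def using bounded_kernel_section[OF assms]
    by (intro integral_mono) (auto simp: L2_def)
  then show ?thesis by (simp add: mult.commute)
qed

lemma sqnorm_section_integrable:
  assumes k: "bounded_kernel M C k"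
  shows "integrable M (\<lambda>t. sqnorm M (k t))"
proof (rule integrable_const_bound[where B = "C\<^sup>2 * measure M (space M)"])
  have [measurable]: "case_prod k \<in> borel_measurable (M \<Otimes>\<^sub>M M)"
    using k by (simp add: bounded_kernel_def)
  show "(\<lambda>t. sqnorm M (k t)) \<in> borel_measurable M"
    unfolding sqnorm_def by measurable
  show "AE t in M. norm (sqnorm M (k t)) \<le> C\<^sup>2 * measure M (space M)"
    by (intro AE_I2) (simp add: sqnorm_section_le[OF k] sqnorm_nonneg)
qed

lemma HS_sqnorm_le:
  assumes k: "bounded_kernel M C k"
  shows "HS_sqnorm M k \<le> C\<^sup>2 * (measure M (space M))\<^sup>2"
proof -
  have "HS_sqnorm M k \<le> (LINT t|M. C\<^sup>2 * measure M (space M))"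
    unfolding HS_sqnorm_def
    using sqnorm_section_le[OF k] sqnorm_section_integrable[OF k] by (intro integral_mono) auto
  then show ?thesis by (simp add: power2_eq_square mult_ac)
qed

lemma HS_sqnorm_nonneg: "0 \<le> HS_sqnorm M k"
  by (simp add: HS_sqnorm_def sqnorm_nonneg)

text \<open>Cauchy-Schwarz in \<open>s\<close> for each fixed \<open>t\<close>, integrated over \<open>t\<close>: the Hilbert-Schmidt norm dominates
  the operator norm.\<close>

lemma
  assumes k: "bounded_kernel M C k" and f: "f \<in> L2 M"
  shows kernel_op_L2: "kernel_op M k f \<in> L2 M"
    and sqnorm_kernel_op_le: "sqnorm M (kernel_op M k f) \<le> HS_sqnorm M k * sqnorm M f"
proof -
  have [measurable]: "case_prod k \<in> borel_measurable (M \<Otimes>\<^sub>M M)" "f \<in> borel_measurable M"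
    using k f by (auto simp: bounded_kernel_def L2_def)
  have pt: "(cmod (kernel_op M k f t))\<^sup>2 \<le> sqnorm M (k t) * sqnorm M f" if "t \<in> space M" for t
    unfolding kernel_op_def by (intro L2_Cauchy_Schwarz f bounded_kernel_section[OF k that])
  have int: "integrable M (\<lambda>t. sqnorm M (k t) * sqnorm M f)"
    using sqnorm_section_integrable[OF k] by simp
  have meas[measurable]: "kernel_op M k f \<in> borel_measurable M"
    unfolding kernel_op_def by measurable
  have int': "integrable M (\<lambda>t. (cmod (kernel_op M k f t))\<^sup>2)"
    by (rule Bochner_Integration.integrable_bound[OF int]) (auto intro!: AE_I2 order_trans[OF pt])
  then show "kernel_op M k f \<in> L2 M"
    by (simp add: L2_def)
  have "sqnorm M (kernel_op M k f) \<le> (LINT t|M. sqnorm M (k t) * sqnorm M f)"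
    unfolding sqnorm_def[of M "kernel_op M k f"] by (intro integral_mono int int' pt)
  then show "sqnorm M (kernel_op M k f) \<le> HS_sqnorm M k * sqnorm M f"
    by (simp add: HS_sqnorm_def)
qed

lemma bounded_kernel_diff:
  assumes "bounded_kernel M C k" "bounded_kernel M C k'"
  shows "bounded_kernel M (2 * C) (\<lambda>t s. k t s - k' t s)"
proof -
  have [measurable]: "case_prod k \<in> borel_measurable (M \<Otimes>\<^sub>M M)" "case_prod k' \<in> borel_measurable (M \<Otimes>\<^sub>M M)"
    using assms by (auto simp: bounded_kernel_def)
  have "(\<lambda>(t, s). k t s - k' t s) \<in> borel_measurable (M \<Otimes>\<^sub>M M)"
    by measurable
  moreover have "cmod (k t s - k' t s) \<le> 2 * C" if "t \<in> space M" "s \<in> space M" for t s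
    using assms that norm_triangle_ineq4[of "k t s" "k' t s"] unfolding bounded_kernel_def
    by (metis add_mono mult_2 order_trans)
  ultimately show ?thesis by (auto simp: bounded_kernel_def)
qed

lemma kernel_op_diff_kernel:
  assumes "bounded_kernel M C k" "bounded_kernel M C k'" "f \<in> L2 M" "t \<in> space M"
  shows "kernel_op M (\<lambda>t s. k t s - k' t s) f t = kernel_op M k f t - kernel_op M k' f t"
  using L2_mult_integrable[OF bounded_kernel_section[OF assms(1,4)] assms(3)]
    L2_mult_integrable[OF bounded_kernel_section[OF assms(2,4)] assms(3)]
  by (simp add: kernel_op_def left_diff_distrib)

lemma kernel_op_diff:
  assumes "bounded_kernel M C k" "f \<in> L2 M" "g \<in> L2 M" "t \<in> space M"
  shows "kernel_op M k (\<lambda>x. f x - g x) t = kernel_op M k f t - kernel_op M k g t"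
  using L2_mult_integrable[OF bounded_kernel_section[OF assms(1,4)] assms(2)]
    L2_mult_integrable[OF bounded_kernel_section[OF assms(1,4)] assms(3)]
  by (simp add: kernel_op_def right_diff_distrib)

text \<open>Dominated convergence twice, in \<open>s\<close> for almost every \<open>t\<close> and then in \<open>t\<close>; on a finite measure space
  the constant bound of the kernels is a majorant both times.\<close>

lemma HS_sqnorm_tendsto_0:
  assumes kn: "\<And>n. bounded_kernel M C (kn n)" and k: "bounded_kernel M C k"
    and lim: "AE t in M. AE s in M. (\<lambda>n. kn n t s) \<longlonglongrightarrow> k t s"
  shows "(\<lambda>n. HS_sqnorm M (\<lambda>t s. kn n t s - k t s)) \<longlonglongrightarrow> 0"
proof -
  define d where "d n t s = kn n t s - k t s" for n t s
  have d: "bounded_kernel M (2 * C) (d n)" for n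
    unfolding d_def by (rule bounded_kernel_diff[OF kn k])
  have d_lim: "AE t in M. AE s in M. (\<lambda>n. d n t s) \<longlonglongrightarrow> 0"
    using lim unfolding d_def by (simp add: LIM_zero_iff)
  have inner: "(\<lambda>n. sqnorm M (d n t)) \<longlonglongrightarrow> 0"
    if t: "t \<in> space M" and lim: "AE s in M. (\<lambda>n. d n t s) \<longlonglongrightarrow> 0" for t
  proof -
    have "(\<lambda>n. LINT s|M. (cmod (d n t s))\<^sup>2) \<longlonglongrightarrow> (LINT s|M. 0)"
    proof (rule integral_dominated_convergence[where w = "\<lambda>_. (2 * C)\<^sup>2"])
      show "(\<lambda>s. (cmod (d n t s))\<^sup>2) \<in> borel_measurable M" for n
        using L2_measurable[OF bounded_kernel_section[OF d t, of n]] by measurable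
      show "AE s in M. (\<lambda>n. (cmod (d n t s))\<^sup>2) \<longlonglongrightarrow> 0"
        using lim by eventually_elim (auto intro: tendsto_eq_intros tendsto_norm_zero)
      show "AE s in M. norm ((cmod (d n t s))\<^sup>2) \<le> (2 * C)\<^sup>2" for n
      proof (intro AE_I2)
        fix s assume "s \<in> space M"
        then have "cmod (d n t s) \<le> 2 * C"
          using d[of n] t by (simp add: bounded_kernel_def)
        then have "(cmod (d n t s))\<^sup>2 \<le> (2 * C)\<^sup>2" by (intro power_mono) auto
        then show "norm ((cmod (d n t s))\<^sup>2) \<le> (2 * C)\<^sup>2" by simp
      qed
    qed auto
    then show ?thesis by (simp add: sqnorm_def)
  qed
  have "(\<lambda>n. LINT t|M. sqnorm M (d n t)) \<longlonglongrightarrow> (LINT t|M. 0)"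
  proof (rule integral_dominated_convergence[where w = "\<lambda>_. (2 * C)\<^sup>2 * measure M (space M)"])
    show "AE t in M. (\<lambda>n. sqnorm M (d n t)) \<longlonglongrightarrow> 0"
      using d_lim AE_space by eventually_elim (rule inner)
    show "AE t in M. norm (sqnorm M (d n t)) \<le> (2 * C)\<^sup>2 * measure M (space M)" for n
      by (intro AE_I2) (simp only: real_norm_def abs_of_nonneg sqnorm_nonneg sqnorm_section_le[OF d])
  qed (use sqnorm_section_integrable[OF d] in auto)
  then show ?thesis by (simp add: HS_sqnorm_def d_def[abs_def])
qed

end

section \<open>Projections onto graphs and gap convergence\<close>

text \<open>For \<open>S = (\<i> + T)\<^sup>-\<^sup>1\<close> this is the graph of \<open>T\<close>.\<close>

definition resolvent_graph :: "'a measure \<Rightarrow> (('a \<Rightarrow> complex) \<Rightarrow> 'a \<Rightarrow> complex) \<Rightarrow> 'a fun_pair set" where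
  "resolvent_graph M S = {(u, v). u \<in> L2 M \<and> v \<in> L2 M \<and>
     (\<exists>f \<in> L2 M. (AE t in M. u t = S f t) \<and> (AE t in M. v t = f t - \<i> * u t))}"

text \<open>The parametrisation \<open>V\<close> of the graph by the whole space.\<close>

definition graph_embed :: "(('a \<Rightarrow> complex) \<Rightarrow> 'a \<Rightarrow> complex) \<Rightarrow> ('a \<Rightarrow> complex) \<Rightarrow> 'a fun_pair" where
  "graph_embed S f = (S f, \<lambda>t. f t - \<i> * S f t)"

text \<open>The adjoint of \<open>V\<close>, when \<open>S'\<close> is the adjoint of \<open>S\<close>.\<close>

definition graph_embed_adj :: "(('a \<Rightarrow> complex) \<Rightarrow> 'a \<Rightarrow> complex) \<Rightarrow> 'a fun_pair \<Rightarrow> 'a \<Rightarrow> complex" where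
  "graph_embed_adj S' p = (\<lambda>t. S' (fst p) t + snd p t + \<i> * S' (snd p) t)"

definition graph_proj :: "'a measure \<Rightarrow> ('a \<Rightarrow> 'a \<Rightarrow> complex) \<Rightarrow> ('a \<Rightarrow> 'a \<Rightarrow> complex) \<Rightarrow> 'a fun_pair \<Rightarrow> 'a fun_pair" where
  "graph_proj M k k' p = graph_embed (kernel_op M k) (graph_embed_adj (kernel_op M k') p)"

context finite_measure
begin

lemma graph_embed_adj_L2:
  assumes "bounded_kernel M C' k'" "p \<in> L2 M \<times> L2 M"
  shows "graph_embed_adj (kernel_op M k') p \<in> L2 M"
  using assms unfolding graph_embed_adj_def
  by (auto intro!: L2_add L2_cmult kernel_op_L2)

text \<open>The hypothesis \<open>res\<close> is the polarised form of \<open>\<parallel>V f\<parallel> = \<parallel>f\<parallel>\<close>, that is \<open>V\<^sup>* V = 1\<close>. With it,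
  \<open>\<langle>p - V V\<^sup>* p, V f\<rangle> = \<langle>V\<^sup>* p, f\<rangle> - \<langle>V\<^sup>* V V\<^sup>* p, f\<rangle>\<close> vanishes.\<close>

lemma is_orth_proj_graph_proj:
  assumes k: "bounded_kernel M C k" and k': "bounded_kernel M C' k'"
    and adj: "\<And>f g. f \<in> L2 M \<Longrightarrow> g \<in> L2 M \<Longrightarrow>
        L2_inner M (kernel_op M k f) g = L2_inner M f (kernel_op M k' g)"
    and res: "\<And>f g. f \<in> L2 M \<Longrightarrow> g \<in> L2 M \<Longrightarrow>
        2 * L2_inner M (kernel_op M k f) (kernel_op M k g)
          = \<i> * L2_inner M (kernel_op M k f) g - \<i> * L2_inner M f (kernel_op M k g)"
  shows "is_orth_proj M (resolvent_graph M (kernel_op M k)) (graph_proj M k k')"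
  unfolding is_orth_proj_def
proof (intro ballI conjI)
  fix p :: "'a fun_pair" assume p: "p \<in> L2 M \<times> L2 M"
  let ?K = "kernel_op M k" and ?K' = "kernel_op M k'"
  obtain p1 p2 where p_eq: "p = (p1, p2)" and p1: "p1 \<in> L2 M" and p2: "p2 \<in> L2 M"
    using p by auto
  note KL = kernel_op_L2[OF k] kernel_op_L2[OF k'] L2_cmult L2_diff L2_add
  define h where "h = graph_embed_adj ?K' p"
  have h: "h \<in> L2 M" unfolding h_def by (rule graph_embed_adj_L2[OF k' p])
  have Pp: "graph_proj M k k' p = (?K h, \<lambda>t. h t - \<i> * ?K h t)"
    by (simp add: graph_proj_def graph_embed_def h_def)
  show "graph_proj M k k' p \<in> resolvent_graph M ?K"
    unfolding Pp resolvent_graph_def using h by (auto intro!: KL)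
  fix q assume "q \<in> resolvent_graph M ?K"
  then obtain u v f where q: "q = (u, v)" and uv: "u \<in> L2 M" "v \<in> L2 M" and f: "f \<in> L2 M"
    and u_eq: "AE t in M. u t = ?K f t" and v_eq: "AE t in M. v t = f t - \<i> * u t"
    by (auto simp: resolvent_graph_def)
  have v_eq': "AE t in M. v t = f t - \<i> * ?K f t"
    using u_eq v_eq by eventually_elim simp
  have inner_q: "sum_inner M (a, b) q = L2_inner M a (?K f) + L2_inner M b f + \<i> * L2_inner M b (?K f)"
    if "a \<in> L2 M" "b \<in> L2 M" for a b
  proof -
    have "L2_inner M a u = L2_inner M a (?K f)"
      by (rule L2_inner_cong_AE_right[OF that(1) uv(1) _ u_eq]) (intro KL f)
    moreover have "L2_inner M b v = L2_inner M b (\<lambda>t. f t - \<i> * ?K f t)"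
      by (rule L2_inner_cong_AE_right[OF that(2) uv(2) _ v_eq']) (intro KL f)
    ultimately show ?thesis
      using that f by (simp add: q sum_inner_def L2_inner_diff_right L2_inner_cmult_right KL)
  qed
  have adj': "L2_inner M g (?K f) = L2_inner M (?K' g) f" if g: "g \<in> L2 M" for g
  proof -
    have "cnj (L2_inner M a b) = L2_inner M b a" for a b
      by (simp add: L2_inner_def mult.commute flip: Bochner_Integration.integral_cnj)
    then show ?thesis by (metis adj[OF f g])
  qed
  have "L2_inner M h f = L2_inner M (?K' p1) f + L2_inner M p2 f + \<i> * L2_inner M (?K' p2) f"
    unfolding h_def graph_embed_adj_def p_eq
    by (simp add: L2_inner_add_left L2_inner_cmult_left KL p1 p2 f)
  then have 1: "sum_inner M (p1, p2) q = L2_inner M h f"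
    by (simp add: inner_q p1 p2 adj')
  have "sum_inner M (?K h, \<lambda>t. h t - \<i> * ?K h t) q
      = L2_inner M (?K h) (?K f) + (L2_inner M h f - \<i> * L2_inner M (?K h) f)
        + \<i> * (L2_inner M h (?K f) - \<i> * L2_inner M (?K h) (?K f))"
    by (simp add: inner_q KL h f L2_inner_diff_left L2_inner_cmult_left)
  also have "\<dots> = L2_inner M h f"
    using res[OF h f] by (simp add: algebra_simps)
  finally have 2: "sum_inner M (?K h, \<lambda>t. h t - \<i> * ?K h t) q = L2_inner M h f" .
  obtain q1 q2 where q': "q = (q1, q2)" "q1 \<in> L2 M" "q2 \<in> L2 M" using q uv by auto
  have "sum_inner M (pair_minus p (graph_proj M k k' p)) q
      = sum_inner M (p1, p2) q - sum_inner M (?K h, \<lambda>t. h t - \<i> * ?K h t) q"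
    unfolding Pp unfolding p_eq pair_minus_def q'(1) sum_inner_def
    by (simp add: L2_inner_diff_left KL h p1 p2 q')
  then show "sum_inner M (pair_minus p (graph_proj M k k' p)) q = 0"
    by (simp add: 1 2)
qed

text \<open>With \<open>h = V\<^sup>* p\<close> and \<open>h\<^sub>n = V\<^sub>n\<^sup>* p\<close>, the first component of the difference is
  \<open>K\<^sub>n h\<^sub>n - K h = K\<^sub>n (h\<^sub>n - h) + (K\<^sub>n - K) h\<close> and the second one is \<open>h\<^sub>n - h\<close> minus \<open>\<i>\<close> times the
  first. The number \<open>B\<close> bounds the squared norms of all four operators; the point is that the
  estimate is uniform in \<open>p\<close> and vanishes with \<open>e\<close> and \<open>e'\<close>.\<close>

lemma graph_proj_diff_le:
  assumes kn: "bounded_kernel M C kn" and k: "bounded_kernel M C k"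
    and kn': "bounded_kernel M C kn'" and k': "bounded_kernel M C k'"
    and p: "p \<in> L2 M \<times> L2 M" and p_le: "sum_norm M p \<le> 1"
    and B_def: "B = C\<^sup>2 * (measure M (space M))\<^sup>2"
    and e_def: "e = HS_sqnorm M (\<lambda>t s. kn t s - k t s)"
    and e'_def: "e' = HS_sqnorm M (\<lambda>t s. kn' t s - k' t s)"
  shows "sum_norm M (pair_minus (graph_proj M kn kn' p) (graph_proj M k k' p))
           \<le> sqrt (3 * (4 * B * e' + (12 * B + 8) * e) + 4 * e')"
proof -
  let ?K = "kernel_op M k" and ?K' = "kernel_op M k'"
  let ?Kn = "kernel_op M kn" and ?Kn' = "kernel_op M kn'"
  let ?D = "kernel_op M (\<lambda>t s. kn t s - k t s)" and ?D' = "kernel_op M (\<lambda>t s. kn' t s - k' t s)"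
  note D = bounded_kernel_diff[OF kn k] and D' = bounded_kernel_diff[OF kn' k']
  note KL = kernel_op_L2[OF k] kernel_op_L2[OF k'] kernel_op_L2[OF kn] kernel_op_L2[OF kn']
    kernel_op_L2[OF D] kernel_op_L2[OF D'] L2_cmult L2_diff L2_add
  obtain p1 p2 where p_eq: "p = (p1, p2)" and p1: "p1 \<in> L2 M" and p2: "p2 \<in> L2 M"
    using p by auto
  have "sqnorm M p1 + sqnorm M p2 \<le> 1"
    using p_le by (simp add: sum_norm_eq p_eq)
  with sqnorm_nonneg[of M p1] sqnorm_nonneg[of M p2]
  have p_le': "sqnorm M p1 \<le> 1" "sqnorm M p2 \<le> 1" "sqnorm M p1 + sqnorm M p2 \<le> 1" by auto
  have B0: "0 \<le> B" by (simp add: B_def)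
  have e0: "0 \<le> e" "0 \<le> e'" by (auto simp: e_def e'_def HS_sqnorm_nonneg)
  have K_le: "sqnorm M (kernel_op M l f) \<le> B * sqnorm M f" if "bounded_kernel M C l" "f \<in> L2 M" for l f
  proof -
    have "HS_sqnorm M l * sqnorm M f \<le> B * sqnorm M f"
      unfolding B_def by (intro mult_right_mono HS_sqnorm_le that sqnorm_nonneg)
    with sqnorm_kernel_op_le[OF that] show ?thesis by linarith
  qed
  have K_le1: "sqnorm M (kernel_op M l f) \<le> B" if "bounded_kernel M C l" "f \<in> L2 M" "sqnorm M f \<le> 1" for l f
    using K_le[OF that(1,2)] mult_left_mono[OF that(3) B0] by simp
  define h where "h = graph_embed_adj ?K' p"
  define hn where "hn = graph_embed_adj ?Kn' p"
  have h: "h \<in> L2 M" and hn: "hn \<in> L2 M"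
    unfolding h_def hn_def using graph_embed_adj_L2 k' kn' p by auto
  define d where "d = (\<lambda>t. hn t - h t)"
  have d: "d \<in> L2 M" unfolding d_def by (intro KL h hn)
  have "sqnorm M d = sqnorm M (\<lambda>t. ?D' p1 t + \<i> * ?D' p2 t)"
    by (rule sqnorm_cong)
       (simp add: d_def h_def hn_def graph_embed_adj_def p_eq p1 p2 kernel_op_diff_kernel[OF kn' k'] algebra_simps)
  also have "\<dots> \<le> 2 * sqnorm M (?D' p1) + 2 * sqnorm M (\<lambda>t. \<i> * ?D' p2 t)"
    by (intro sqnorm_add_le KL p1 p2)
  also have "\<dots> \<le> 2 * (e' * sqnorm M p1) + 2 * (e' * sqnorm M p2)"
    using sqnorm_kernel_op_le[OF D' p1] sqnorm_kernel_op_le[OF D' p2]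
    by (simp add: sqnorm_cmult e'_def)
  also have "\<dots> = 2 * (e' * (sqnorm M p1 + sqnorm M p2))"
    by (simp add: algebra_simps)
  also have "\<dots> \<le> 2 * e'"
    using mult_left_mono[OF p_le'(3) e0(2)] by simp
  finally have d_le: "sqnorm M d \<le> 2 * e'" .
  \<comment> \<open>\<open>h\<close> is a sum of three terms of squared norm at most \<open>B\<close>, \<open>1\<close> and \<open>B\<close>; the factor \<open>2\<close> enters twice.\<close>
  have "sqnorm M h \<le> 2 * sqnorm M (\<lambda>t. ?K' p1 t + p2 t) + 2 * sqnorm M (\<lambda>t. \<i> * ?K' p2 t)"
    unfolding h_def graph_embed_adj_def p_eq fst_conv snd_conv by (intro sqnorm_add_le KL p1 p2)
  also have "\<dots> \<le> 2 * (2 * sqnorm M (?K' p1) + 2 * sqnorm M p2) + 2 * sqnorm M (?K' p2)"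
    using sqnorm_add_le[OF kernel_op_L2[OF k' p1] p2] by (simp add: sqnorm_cmult)
  also have "\<dots> \<le> 6 * B + 4"
    using K_le1[OF k' p1] K_le1[OF k' p2] p_le' by simp
  finally have h_le: "sqnorm M h \<le> 6 * B + 4" .
  define u where "u = (\<lambda>t. ?Kn hn t - ?K h t)"
  have u: "u \<in> L2 M" unfolding u_def by (intro KL h hn)
  have "sqnorm M u = sqnorm M (\<lambda>t. ?Kn d t + ?D h t)"
    by (rule sqnorm_cong)
       (simp add: u_def d_def kernel_op_diff[OF kn hn h] kernel_op_diff_kernel[OF kn k h])
  also have "\<dots> \<le> 2 * sqnorm M (?Kn d) + 2 * sqnorm M (?D h)"
    by (intro sqnorm_add_le KL h d)
  also have "\<dots> \<le> 2 * (B * (2 * e')) + 2 * (e * (6 * B + 4))"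
    using K_le[OF kn d] mult_left_mono[OF d_le B0] sqnorm_kernel_op_le[OF D h]
      mult_left_mono[OF h_le e0(1)] unfolding e_def[symmetric] by linarith
  finally have u_le: "sqnorm M u \<le> 4 * B * e' + (12 * B + 8) * e"
    by (simp add: algebra_simps)
  define w where "w = (\<lambda>t. d t - \<i> * u t)"
  have "sqnorm M w \<le> 2 * sqnorm M d + 2 * sqnorm M (\<lambda>t. \<i> * u t)"
    unfolding w_def by (intro sqnorm_diff_le KL d u)
  also have "\<dots> \<le> 4 * e' + 2 * sqnorm M u"
    using d_le by (simp add: sqnorm_cmult)
  finally have w_le: "sqnorm M w \<le> 4 * e' + 2 * sqnorm M u" .
  have "pair_minus (graph_proj M kn kn' p) (graph_proj M k k' p) = (u, w)"
    by (simp add: pair_minus_def graph_proj_def graph_embed_def u_def w_def d_def h_def hn_def algebra_simps)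
  then show ?thesis
    using u_le w_le by (simp add: sum_norm_eq)
qed

lemma gap_converges_kernel:
  assumes kn: "\<And>n. bounded_kernel M C (kn n)" and k: "bounded_kernel M C k"
    and kn': "\<And>n. bounded_kernel M C (kn' n)" and k': "bounded_kernel M C k'"
    and lim: "AE t in M. AE s in M. (\<lambda>n. kn n t s) \<longlonglongrightarrow> k t s"
    and lim': "AE t in M. AE s in M. (\<lambda>n. kn' n t s) \<longlonglongrightarrow> k' t s"
    and projn: "\<And>n. is_orth_proj M (\<Gamma> n) (graph_proj M (kn n) (kn' n))"
    and proj: "is_orth_proj M G (graph_proj M k k')"
  shows "gap_converges M \<Gamma> G"
proof -
  define B where "B = C\<^sup>2 * (measure M (space M))\<^sup>2"
  define e where "e n = HS_sqnorm M (\<lambda>t s. kn n t s - k t s)" for n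
  define e' where "e' n = HS_sqnorm M (\<lambda>t s. kn' n t s - k' t s)" for n
  define E where "E n = ennreal (sqrt (3 * (4 * B * e' n + (12 * B + 8) * e n) + 4 * e' n))" for n
  have "e \<longlonglongrightarrow> 0" "e' \<longlonglongrightarrow> 0"
    unfolding e_def e'_def
    by (rule HS_sqnorm_tendsto_0[OF kn k lim], rule HS_sqnorm_tendsto_0[OF kn' k' lim'])
  then have "(\<lambda>n. sqrt (3 * (4 * B * e' n + (12 * B + 8) * e n) + 4 * e' n))
      \<longlonglongrightarrow> sqrt (3 * (4 * B * 0 + (12 * B + 8) * 0) + 4 * 0)"
    by (intro tendsto_intros)
  then have E0: "E \<longlonglongrightarrow> 0"
    unfolding E_def by (auto dest: tendsto_ennrealI)
  have le: "sum_opnorm M (\<lambda>p. pair_minus (graph_proj M (kn n) (kn' n) p) (graph_proj M k k' p)) \<le> E n" for n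
    unfolding sum_opnorm_def E_def
  proof (intro SUP_least ennreal_leI)
    fix p :: "'a fun_pair" assume "p \<in> {p \<in> L2 M \<times> L2 M. sum_norm M p \<le> 1}"
    then show "sum_norm M (pair_minus (graph_proj M (kn n) (kn' n) p) (graph_proj M k k' p))
      \<le> sqrt (3 * (4 * B * e' n + (12 * B + 8) * e n) + 4 * e' n)"
      by (intro graph_proj_diff_le[OF kn k kn' k'] B_def e_def e'_def) auto
  qed
  have "(\<lambda>n. sum_opnorm M (\<lambda>p. pair_minus (graph_proj M (kn n) (kn' n) p) (graph_proj M k k' p))) \<longlonglongrightarrow> 0"
    by (rule tendsto_sandwich[OF _ _ tendsto_const E0]) (auto simp: le)
  with projn proj show ?thesis
    unfolding gap_converges_def
    by (intro exI[of _ "\<lambda>n. graph_proj M (kn n) (kn' n)"] exI[of _ "graph_proj M k k'"]) simp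
qed

end

section \<open>Integration by parts for primitives\<close>

text \<open>The truncation is placed in the integrand, so that primitives for all end points are integrals over
  the same measure and Fubini applies to them directly.\<close>

definition primitive :: "real measure \<Rightarrow> (real \<Rightarrow> complex) \<Rightarrow> real \<Rightarrow> complex" where
  "primitive M f t = (LINT s|M. (if s \<le> t then f s else 0))"

locale atomless_real_measure = finite_measure M for M :: "real measure" +
  assumes id_measurable [measurable]: "(\<lambda>x. x) \<in> borel_measurable M"
    and AE_neq: "AE s in M. s \<noteq> t"
begin

lemma integrable_truncate:
  assumes "integrable M f"
  shows "integrable M (\<lambda>s. if s \<le> t then f s else 0 :: complex)"
proof -
  have [measurable]: "f \<in> borel_measurable M" using assms by auto
  show ?thesis
    by (rule Bochner_Integration.integrable_bound[OF assms]) auto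
qed

lemma cmod_primitive_le:
  assumes "integrable M f"
  shows "cmod (primitive M f t) \<le> (LINT s|M. cmod (f s))"
proof -
  have "cmod (primitive M f t) \<le> (LINT s|M. cmod (if s \<le> t then f s else 0))"
    unfolding primitive_def by (rule integral_norm_bound)
  also have "\<dots> \<le> (LINT s|M. cmod (f s))"
    using assms integrable_truncate[OF assms, of t] by (intro integral_mono integrable_norm) auto
  finally show ?thesis .
qed

lemma primitive_measurable:
  assumes "integrable M f"
  shows "primitive M f \<in> borel_measurable M"
proof -
  have [measurable]: "f \<in> borel_measurable M" using assms by auto
  show ?thesis unfolding primitive_def by measurable
qed

lemma integrable_mult_primitive:
  assumes f: "integrable M f" and g: "integrable M g"
  shows "integrable M (\<lambda>t. f t * primitive M g t)"
proof (rule Bochner_Integration.integrable_bound)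
  show "integrable M (\<lambda>t. (LINT s|M. cmod (g s)) * cmod (f t))" using f by auto
  show "(\<lambda>t. f t * primitive M g t) \<in> borel_measurable M"
    using primitive_measurable[OF g] f by (intro borel_measurable_times) auto
  show "AE t in M. cmod (f t * primitive M g t) \<le> norm ((LINT s|M. cmod (g s)) * cmod (f t))"
    using cmod_primitive_le[OF g] by (intro AE_I2) (auto simp: norm_mult abs_mult mult.commute intro!: mult_mono)
qed

text \<open>Integration by parts for absolutely continuous functions. The product of the integrals is the
  integral of \<open>f(t) g(s)\<close> over the square. Fubini on the triangle below the diagonal gives the first summand and on
  the triangle above it the second; the diagonal is null because \<open>M\<close> has no atoms.\<close>

lemma integral_mult_integral:
  assumes f: "integrable M f" and g: "integrable M g"
  shows "(LINT t|M. f t) * (LINT t|M. g t)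
           = (LINT t|M. f t * primitive M g t + primitive M f t * g t)"
proof -
  interpret pair_sigma_finite M M ..
  have [measurable]: "f \<in> borel_measurable M" "g \<in> borel_measurable M" using f g by auto
  define h where "h t s = (if s \<le> t then f t * g s else 0)" for t s
  have row: "(\<lambda>s. h t s) = (\<lambda>s. f t * (if s \<le> t then g s else 0))" for t
    by (auto simp: h_def)
  have h_int: "integrable (M \<Otimes>\<^sub>M M) (case_prod h)"
  proof (rule Fubini_integrable)
    show "case_prod h \<in> borel_measurable (M \<Otimes>\<^sub>M M)"
      unfolding h_def by measurable
    have "(LINT s|M. norm (h t s)) = cmod (f t) * (LINT s|M. cmod (if s \<le> t then g s else 0))" for t
      unfolding row norm_mult by simp
    moreover have "integrable M (\<lambda>t. cmod (f t) * (LINT s|M. cmod (if s \<le> t then g s else 0)))"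
    proof (rule Bochner_Integration.integrable_bound)
      show "integrable M (\<lambda>t. (LINT s|M. cmod (g s)) * cmod (f t))" using f by auto
      have "(LINT s|M. cmod (if s \<le> t then g s else 0)) \<le> (LINT s|M. cmod (g s))" for t
        using g integrable_truncate[OF g, of t] by (intro integral_mono integrable_norm) auto
      then show "AE t in M. norm (cmod (f t) * (LINT s|M. cmod (if s \<le> t then g s else 0)))
          \<le> norm ((LINT s|M. cmod (g s)) * cmod (f t))"
        by (intro AE_I2) (auto simp: abs_mult mult.commute intro!: mult_mono)
    qed measurable
    ultimately show "integrable M (\<lambda>t. LINT s|M. norm (case_prod h (t, s)))" by simp
    show "AE t in M. integrable M (\<lambda>s. case_prod h (t, s))"
      using integrable_truncate[OF g] by (intro AE_I2) (simp add: row)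
  qed
  have "(LINT t|M. f t * primitive M g t) = (LINT t|M. LINT s|M. h t s)"
    unfolding row primitive_def by simp
  also have "\<dots> = (LINT s|M. LINT t|M. h t s)"
    by (rule Fubini_integral[OF h_int, symmetric])
  also have "\<dots> = (LINT s|M. (LINT t|M. f t) * g s - primitive M f s * g s)"
  proof (rule Bochner_Integration.integral_cong[OF refl])
    fix s
    \<comment> \<open>\<open>h\<close> lives on \<open>t \<ge> s\<close>, the truncation removes \<open>t \<le> s\<close>: they differ at \<open>t = s\<close> only.\<close>
    have "(LINT t|M. h t s) = (LINT t|M. (f t - (if t \<le> s then f t else 0)) * g s)"
    proof (rule integral_cong_AE)
      show "AE t in M. h t s = (f t - (if t \<le> s then f t else 0)) * g s"
        using AE_neq[of s] by eventually_elim (auto simp: h_def)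
    qed (unfold h_def, measurable)
    also have "\<dots> = (LINT t|M. f t - (if t \<le> s then f t else 0)) * g s"
      by simp
    also have "\<dots> = (LINT t|M. f t) * g s - primitive M f s * g s"
      using f integrable_truncate[OF f, of s] by (simp add: primitive_def left_diff_distrib)
    finally show "(LINT t|M. h t s) = (LINT t|M. f t) * g s - primitive M f s * g s" .
  qed
  also have "\<dots> = (LINT t|M. f t) * (LINT t|M. g t) - (LINT s|M. primitive M f s * g s)"
    using g integrable_mult_primitive[OF g f] by (simp add: mult.commute)
  finally show ?thesis
    using integrable_mult_primitive[OF f g] integrable_mult_primitive[OF g f]
    by (simp add: mult.commute)
qed

text \<open>Truncating both factors at \<open>T\<close> reduces the claim to the full integrals, since the truncation does
  not change the primitives up to \<open>T\<close>.\<close>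

lemma primitive_mult:
  assumes f: "integrable M f" and g: "integrable M g"
  shows "primitive M f T * primitive M g T
           = primitive M (\<lambda>t. f t * primitive M g t + primitive M f t * g t) T"
proof -
  let ?tr = "\<lambda>h t. if t \<le> T then h t else 0 :: complex"
  have tr: "primitive M (?tr h) t = primitive M h t" if "t \<le> T" for h t
    unfolding primitive_def by (intro Bochner_Integration.integral_cong) (use that in auto)
  have "primitive M f T * primitive M g T = (LINT t|M. ?tr f t * primitive M (?tr g) t + primitive M (?tr f) t * ?tr g t)"
    unfolding primitive_def[of M f T] primitive_def[of M g T]
    by (rule integral_mult_integral[OF integrable_truncate[OF f] integrable_truncate[OF g]])
  also have "\<dots> = primitive M (\<lambda>t. f t * primitive M g t + primitive M f t * g t) T"
    unfolding primitive_def[of M "\<lambda>t. f t * primitive M g t + primitive M f t * g t"]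
    by (intro Bochner_Integration.integral_cong) (auto simp: tr)
  finally show ?thesis .
qed

lemma primitive_add:
  assumes "integrable M f" "integrable M g"
  shows "primitive M (\<lambda>t. f t + g t) T = primitive M f T + primitive M g T"
proof -
  have "primitive M (\<lambda>t. f t + g t) T = (LINT s|M. (if s \<le> T then f s else 0) + (if s \<le> T then g s else 0))"
    unfolding primitive_def by (intro Bochner_Integration.integral_cong) auto
  then show ?thesis
    using integrable_truncate[OF assms(1), of T] integrable_truncate[OF assms(2), of T]
    by (simp add: primitive_def)
qed

lemma primitive_cmult: "primitive M (\<lambda>t. c * f t) T = c * primitive M f T"
proof -
  have "primitive M (\<lambda>t. c * f t) T = (LINT s|M. c * (if s \<le> T then f s else 0))"
    unfolding primitive_def by (intro Bochner_Integration.integral_cong) auto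
  then show ?thesis by (simp add: primitive_def)
qed

text \<open>The product rule in integrated form. The hypothesis on \<open>F\<close> and \<open>G\<close> is the definition of absolute
  continuity, and the conclusions say that \<open>F G\<close> is again absolutely continuous, so the rule can be
  applied to three factors in succession.\<close>

lemma primitive_product_rule:
  assumes f: "integrable M f" and g: "integrable M g"
    and F: "\<And>t. t \<in> space M \<Longrightarrow> F t = a + primitive M f t"
    and G: "\<And>t. t \<in> space M \<Longrightarrow> G t = b + primitive M g t"
  shows "integrable M (\<lambda>t. f t * G t + F t * g t)" (is ?int)
    and "T \<in> space M \<Longrightarrow> F T * G T = a * b + primitive M (\<lambda>t. f t * G t + F t * g t) T"
proof -
  let ?p = "\<lambda>t. f t * primitive M g t + primitive M f t * g t"
  have p_int: "integrable M ?p"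
    using integrable_mult_primitive[OF f g] integrable_mult_primitive[OF g f]
    by (simp add: mult.commute)
  have eq: "f t * G t + F t * g t = b * f t + a * g t + ?p t" if "t \<in> space M" for t
    by (simp add: F[OF that] G[OF that] algebra_simps)
  have "integrable M (\<lambda>t. b * f t + a * g t + ?p t)"
    using f g by (intro Bochner_Integration.integrable_add[OF Bochner_Integration.integrable_add p_int]) auto
  then show ?int
    by (subst Bochner_Integration.integrable_cong[OF refl eq])
  have "primitive M (\<lambda>t. f t * G t + F t * g t) T = primitive M (\<lambda>t. b * f t + a * g t + ?p t) T"
    unfolding primitive_def[of M _ T] by (intro Bochner_Integration.integral_cong) (auto simp: eq)
  also have "\<dots> = b * primitive M f T + a * primitive M g T + primitive M ?p T"
    by (subst primitive_add[OF _ p_int]; (subst primitive_add)?)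
       (use f g in \<open>auto simp: primitive_cmult intro!: Bochner_Integration.integrable_add\<close>)
  finally have "primitive M (\<lambda>t. f t * G t + F t * g t) T
      = b * primitive M f T + a * primitive M g T + primitive M f T * primitive M g T"
    by (simp only: primitive_mult[OF f g])
  then show "F T * G T = a * b + primitive M (\<lambda>t. f t * G t + F t * g t) T" if "T \<in> space M"
    by (simp add: F[OF that] G[OF that] algebra_simps)
qed

end

lemma atomless_real_measure_lebesgue_on: "atomless_real_measure (lebesgue_on {a..b::real})"
proof -
  interpret finite_measure "lebesgue_on {a..b}"
    by (rule finite_measure_lebesgue_on) simp
  show ?thesis
  proof
    show "(\<lambda>x. x) \<in> borel_measurable (lebesgue_on {a..b})"
      by (intro measurable_restrict_space1 measurable_completion) simp
    fix t :: real
    have "AE s in lebesgue. s \<noteq> t"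
      using AE_not_in[of "{t}" lebesgue] negligible_iff_null_sets[of "{t}"] by simp
    then have "AE s in lebesgue. s \<in> {a..b} \<longrightarrow> s \<noteq> t"
      by (rule eventually_mono) simp
    then show "AE s in lebesgue_on {a..b}. s \<noteq> t"
      by (subst AE_restrict_space_iff) simp_all
  qed
qed

lemma primitive_lebesgue_on:
  assumes "t \<in> {0..L}"
  shows "primitive (lebesgue_on {0..L}) f t = (LINT s:{0..t}|lebesgue. f s)"
proof -
  have "primitive (lebesgue_on {0..L}) f t
      = (LINT s|lebesgue. indicator {0..L} s *\<^sub>R (if s \<le> t then f s else 0))"
    unfolding primitive_def by (rule integral_restrict_space) simp
  also have "\<dots> = (LINT s:{0..t}|lebesgue. f s)"
    unfolding set_lebesgue_integral_def
    by (intro Bochner_Integration.integral_cong) (use assms in \<open>auto simp: indicator_def\<close>)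
  finally show ?thesis .
qed

lemma primitive_exp:
  fixes \<kappa> :: complex
  assumes "t \<in> {0..L}"
  shows "exp (\<kappa> * of_real t) = 1 + primitive (lebesgue_on {0..L}) (\<lambda>s. \<kappa> * exp (\<kappa> * of_real s)) t"
proof -
  let ?f = "\<lambda>s. \<kappa> * exp (\<kappa> * of_real s)"
  have cont: "continuous_on {0..t} ?f"
    by (intro continuous_intros)
  then have int: "set_integrable lebesgue {0..t} ?f"
    by (metis absolutely_integrable_continuous_real)
  have "((\<lambda>s. exp (\<kappa> * of_real s)) has_vector_derivative ?f s) (at s within {0..t})" for s
  proof -
    have "((\<lambda>z. exp (\<kappa> * z)) has_field_derivative ?f s) (at (of_real s))"
      by (auto intro!: derivative_eq_intros)
    then show ?thesis
      by (rule has_vector_derivative_real_field)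
  qed
  then have "(?f has_integral exp (\<kappa> * of_real t) - exp (\<kappa> * of_real 0)) {0..t}"
    by (intro fundamental_theorem_of_calculus) (use assms in auto)
  then have "integral {0..t} ?f = exp (\<kappa> * of_real t) - 1"
    by (simp only: integral_unique of_real_0 mult_zero_right exp_zero)
  then show ?thesis
    by (simp only: primitive_lebesgue_on[OF assms] set_lebesgue_integral_eq_integral(2)[OF int]) simp
qed

section \<open>Measurability of admissible functions\<close>

text \<open>A right-continuous function is the limit of the step functions that sample it at the next point of
  the grid of width \<open>1/(n+1)\<close> strictly to the right; the minimum with \<open>L\<close> keeps the samples in the interval
  and makes them exact at \<open>t = L\<close>, where no right continuity is available.\<close>

lemma admissible_measurable:
  assumes "admissible L A"
  shows "A \<in> borel_measurable (lebesgue_on {0..L})"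
proof (rule borel_measurable_LIMSEQ_real)
  define x where "x n t = min L ((of_int \<lfloor>of_nat (Suc n) * t\<rfloor> + 1) / of_nat (Suc n))" for n and t :: real
  have "(\<lambda>t::real. A (min L ((of_int \<lfloor>of_nat (Suc n) * t\<rfloor> + 1) / of_nat (Suc n)))) \<in> borel_measurable borel" for n
  proof -
    have "(\<lambda>t::real. \<lfloor>of_nat (Suc n) * t\<rfloor>) \<in> borel \<rightarrow>\<^sub>M count_space UNIV"
      by (rule measurable_compose[OF _ measurable_real_floor]) simp
    then show ?thesis
      by (rule measurable_compose[where g = "\<lambda>i::int. A (min L ((of_int i + 1) / of_nat (Suc n)))"]) simp
  qed
  then show "(\<lambda>t. A (x n t)) \<in> borel_measurable (lebesgue_on {0..L})" for n
    unfolding x_def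
    by (intro measurable_restrict_space1) (simp add: measurable_completion)
  fix t assume "t \<in> space (lebesgue_on {0..L})"
  then have t: "0 \<le> t" "t \<le> L" by auto
  have low: "t < (of_int \<lfloor>of_nat (Suc n) * t\<rfloor> + 1) / of_nat (Suc n)" for n
    by (subst pos_less_divide_eq) (auto simp: mult.commute)
  have upp: "(of_int \<lfloor>of_nat (Suc n) * t\<rfloor> + 1) / of_nat (Suc n) \<le> t + 1 / of_nat (Suc n)" for n
    by (simp add: divide_simps) (simp add: mult.commute)
  show "(\<lambda>n. A (x n t)) \<longlonglongrightarrow> A t"
  proof (cases "t = L")
    case True
    then have "x n t = t" for n using low[of n] by (simp add: x_def)
    then show ?thesis by simp
  next
    case False
    have above: "x n t > t" for n
      using low[of n] t False unfolding x_def by linarith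
    have below: "x n t \<le> t + 1 / of_nat (Suc n)" for n
      using upp[of n] unfolding x_def by linarith
    have "(\<lambda>n. t + 1 / of_nat (Suc n)) \<longlonglongrightarrow> t + 0"
      by (intro tendsto_intros LIMSEQ_Suc lim_1_over_n)
    then have "(\<lambda>n. t + 1 / of_nat (Suc n)) \<longlonglongrightarrow> t"
      by (simp only: add_0_right)
    then have "(\<lambda>n. x n t) \<longlonglongrightarrow> t"
      by (rule tendsto_sandwich[OF always_eventually always_eventually tendsto_const, rotated 2])
         (simp_all only: above below less_imp_le simp_thms)
    moreover note above
    ultimately have "filterlim (\<lambda>n. x n t) (at_right t) sequentially"
      by (simp add: filterlim_at less_imp_neq[symmetric])
    moreover have "(A \<longlongrightarrow> A t) (at_right t)"
      using assms t False by (auto simp: admissible_def continuous_within)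
    ultimately show ?thesis
      by (rule filterlim_compose[rotated])
  qed
qed

section \<open>The kernels of the resolvents\<close>

text \<open>The exponent \<open>\<Phi>\<^sub>A\<close> with the rate \<open>1\<close> replaced by \<open>\<sigma>\<close>. The rate \<open>-1\<close> yields the adjoint of
  \<open>R\<^sub>A\<close>.\<close>

definition twist_exponent :: "(real \<Rightarrow> real) \<Rightarrow> real \<Rightarrow> real \<Rightarrow> complex" where
  "twist_exponent A \<sigma> t = \<i> * of_real (A t) - of_real (\<sigma> * t)"

text \<open>The constant of integration that enforces the boundary condition \<open>y(L) = e\<^bsup>iA(L)\<^esup> y(0)\<close>.\<close>

definition bc_coeff :: "real \<Rightarrow> (real \<Rightarrow> real) \<Rightarrow> real \<Rightarrow> complex" where
  "bc_coeff L A \<sigma> = 1 / (exp (twist_exponent A \<sigma> L) - 1)"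

definition res_kernel :: "real \<Rightarrow> (real \<Rightarrow> real) \<Rightarrow> real \<Rightarrow> real \<Rightarrow> real \<Rightarrow> complex" where
  "res_kernel L A \<sigma> t s = \<i> * exp (- (twist_exponent A \<sigma> t - twist_exponent A \<sigma> s))
     * (bc_coeff L A \<sigma> + (if s \<le> t then 1 else 0))"

lemma cmod_exp_twist: "cmod (exp (twist_exponent A \<sigma> t)) = exp (- (\<sigma> * t))"
  by (simp add: twist_exponent_def)

lemma twist_boundary_neq_1:
  assumes "L > 0" "\<sigma> \<noteq> 0"
  shows "exp (twist_exponent A \<sigma> L) \<noteq> 1"
proof
  assume "exp (twist_exponent A \<sigma> L) = 1"
  then have "exp (- (\<sigma> * L)) = 1" using cmod_exp_twist[of A \<sigma> L] by simp
  with assms show False by simp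
qed

text \<open>The boundary factor lies on the circle of radius \<open>e\<^bsup>-\<sigma>L\<^esup> \<noteq> 1\<close> whatever \<open>A\<close> is, so its distance from
  \<open>1\<close> is bounded below uniformly in \<open>A\<close>.\<close>

lemma cmod_bc_coeff_le:
  assumes "L > 0" "\<sigma> \<noteq> 0"
  shows "cmod (bc_coeff L A \<sigma>) \<le> 1 / \<bar>exp (- (\<sigma> * L)) - 1\<bar>"
proof -
  have "\<bar>exp (- (\<sigma> * L)) - 1\<bar> \<le> cmod (exp (twist_exponent A \<sigma> L) - 1)"
    using norm_triangle_ineq3[of "exp (twist_exponent A \<sigma> L)" 1] unfolding cmod_exp_twist norm_one .
  moreover have "0 < \<bar>exp (- (\<sigma> * L)) - 1\<bar>" using assms by simp
  ultimately show ?thesis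
    unfolding bc_coeff_def norm_divide by (simp add: frac_le)
qed

lemma exp_twist_measurable:
  assumes A: "A \<in> borel_measurable (lebesgue_on {0..L})"
  shows "(\<lambda>t. exp (twist_exponent A \<sigma> t)) \<in> borel_measurable (lebesgue_on {0..L})"
proof -
  have "twist_exponent A \<sigma> \<in> borel_measurable (lebesgue_on {0..L})"
    unfolding twist_exponent_def[abs_def]
    by (intro borel_measurable_diff borel_measurable_times borel_measurable_const
        measurable_compose[OF _ borel_measurable_of_real] A
        atomless_real_measure.id_measurable[OF atomless_real_measure_lebesgue_on])
  then show ?thesis
    by (rule measurable_compose[OF _ borel_measurable_continuous_onI[OF continuous_on_exp[OF continuous_on_id]]])
qed

definition kernel_bound :: "real \<Rightarrow> real \<Rightarrow> real" where
  "kernel_bound L \<sigma> = exp (\<bar>\<sigma>\<bar> * L) * (1 / \<bar>exp (- (\<sigma> * L)) - 1\<bar> + 1)"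

lemma bounded_res_kernel:
  assumes "L > 0" "\<sigma> \<noteq> 0" and A: "A \<in> borel_measurable (lebesgue_on {0..L})"
  shows "bounded_kernel (lebesgue_on {0..L}) (kernel_bound L \<sigma>) (res_kernel L A \<sigma>)"
proof -
  let ?M = "lebesgue_on {0..L}"
  interpret atomless_real_measure ?M
    by (rule atomless_real_measure_lebesgue_on)
  have coord: "fst \<in> borel_measurable (?M \<Otimes>\<^sub>M ?M)" "snd \<in> borel_measurable (?M \<Otimes>\<^sub>M ?M)"
    by (rule measurable_compose[OF measurable_fst id_measurable] measurable_compose[OF measurable_snd id_measurable])+
  have twist: "(\<lambda>p. twist_exponent A \<sigma> (fst p)) \<in> borel_measurable (?M \<Otimes>\<^sub>M ?M)"
    "(\<lambda>p. twist_exponent A \<sigma> (snd p)) \<in> borel_measurable (?M \<Otimes>\<^sub>M ?M)"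
    unfolding twist_exponent_def
    by (intro borel_measurable_diff borel_measurable_times measurable_compose[OF _ borel_measurable_continuous_onI[OF continuous_on_of_real[OF continuous_on_id]]] borel_measurable_const
        coord measurable_compose[OF measurable_fst A] measurable_compose[OF measurable_snd A])+
  have "case_prod (res_kernel L A \<sigma>) \<in> borel_measurable (?M \<Otimes>\<^sub>M ?M)"
    unfolding res_kernel_def split_beta'
    by (intro borel_measurable_times borel_measurable_add borel_measurable_const borel_measurable_exp
        borel_measurable_uminus borel_measurable_diff twist measurable_If borel_measurable_le coord
        measurable_compose[OF _ borel_measurable_continuous_onI[OF continuous_on_exp[OF continuous_on_id]]])
  moreover have "cmod (res_kernel L A \<sigma> t s) \<le> kernel_bound L \<sigma>" if "t \<in> {0..L}" "s \<in> {0..L}" for t s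
  proof -
    have "\<sigma> * (t - s) \<le> \<bar>\<sigma>\<bar> * \<bar>t - s\<bar>"
      by (metis abs_ge_self abs_mult)
    also have "\<dots> \<le> \<bar>\<sigma>\<bar> * L" using that by (intro mult_left_mono) auto
    finally have "cmod (exp (- (twist_exponent A \<sigma> t - twist_exponent A \<sigma> s))) \<le> exp (\<bar>\<sigma>\<bar> * L)"
      by (simp add: twist_exponent_def algebra_simps)
    moreover have "cmod (bc_coeff L A \<sigma> + (if s \<le> t then 1 else 0)) \<le> 1 / \<bar>exp (- (\<sigma> * L)) - 1\<bar> + 1"
      using cmod_bc_coeff_le[OF assms(1,2), of A] norm_triangle_ineq[of "bc_coeff L A \<sigma>" "if s \<le> t then 1 else 0"]
      by (auto split: if_splits)
    ultimately show ?thesis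
      unfolding res_kernel_def kernel_bound_def norm_mult by (auto intro!: mult_mono)
  qed
  ultimately show ?thesis by (simp add: bounded_kernel_def)
qed

lemma res_kernel_tendsto:
  assumes "L > 0" "\<sigma> \<noteq> 0" "(\<lambda>n. An n L) \<longlonglongrightarrow> A L" "(\<lambda>n. An n t) \<longlonglongrightarrow> A t" "(\<lambda>n. An n s) \<longlonglongrightarrow> A s"
  shows "(\<lambda>n. res_kernel L (An n) \<sigma> t s) \<longlonglongrightarrow> res_kernel L A \<sigma> t s"
proof -
  have tw: "(\<lambda>n. twist_exponent (An n) \<sigma> r) \<longlonglongrightarrow> twist_exponent A \<sigma> r" if "(\<lambda>n. An n r) \<longlonglongrightarrow> A r" for r
    unfolding twist_exponent_def by (rule tendsto_diff[OF tendsto_mult_left[OF tendsto_of_real[OF that]] tendsto_const])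
  have bc: "(\<lambda>n. bc_coeff L (An n) \<sigma>) \<longlonglongrightarrow> bc_coeff L A \<sigma>"
    unfolding bc_coeff_def using twist_boundary_neq_1[OF assms(1,2)]
    by (intro tendsto_divide tendsto_diff tendsto_exp tendsto_const tw assms(3)) simp
  show ?thesis
    unfolding res_kernel_def by (intro tendsto_mult tendsto_add tendsto_minus tendsto_diff tendsto_exp tendsto_const tw bc assms)
qed

text \<open>The kernel involves \<open>A(L)\<close> besides \<open>A(t)\<close> and \<open>A(s)\<close>; this is where the convergence at the end
  point \<open>L\<close> is used.\<close>

lemma res_kernel_tendsto_AE:
  assumes "L > 0" "\<sigma> \<noteq> 0" "very_weakly_converges L An A"
  shows "AE t in lebesgue_on {0..L}. AE s in lebesgue_on {0..L}.
           (\<lambda>n. res_kernel L (An n) \<sigma> t s) \<longlonglongrightarrow> res_kernel L A \<sigma> t s"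
proof -
  obtain \<Delta> where \<Delta>: "\<Delta> \<subseteq> {0<..<L}" "negligible \<Delta>"
    and lim: "\<And>t. t \<in> {0..L} - \<Delta> \<Longrightarrow> (\<lambda>n. An n t) \<longlonglongrightarrow> A t"
    using assms(3) unfolding very_weakly_converges_def by blast
  have "AE t in lebesgue. t \<notin> \<Delta>"
    using \<Delta>(2) AE_not_in negligible_iff_null_sets by blast
  then have "AE t in lebesgue. t \<in> {0..L} \<longrightarrow> (\<lambda>n. An n t) \<longlonglongrightarrow> A t"
    by (rule eventually_mono) (simp add: lim)
  then have ae: "AE t in lebesgue_on {0..L}. (\<lambda>n. An n t) \<longlonglongrightarrow> A t"
    by (subst AE_restrict_space_iff) simp_all
  have L: "(\<lambda>n. An n L) \<longlonglongrightarrow> A L" using \<Delta>(1) assms(1) by (intro lim) auto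
  show ?thesis
    using ae
  proof eventually_elim
    case t: (elim t)
    show ?case using ae
      by eventually_elim (rule res_kernel_tendsto[OF assms(1,2) L t])
  qed
qed

lemma exp_twist_L2:
  assumes "A \<in> borel_measurable (lebesgue_on {0..L})"
  shows "(\<lambda>t. exp (twist_exponent A \<sigma> t)) \<in> L2 (lebesgue_on {0..L})"
proof -
  interpret atomless_real_measure "lebesgue_on {0..L}"
    by (rule atomless_real_measure_lebesgue_on)
  show ?thesis
  proof (rule L2_bounded[OF exp_twist_measurable[OF assms]])
    fix t assume "t \<in> space (lebesgue_on {0..L})"
    then have t: "0 \<le> t" "t \<le> L" by auto
    have "- (\<sigma> * t) \<le> \<bar>\<sigma>\<bar> * \<bar>t\<bar>" by (metis abs_ge_minus_self abs_mult)
    also have "\<dots> \<le> \<bar>\<sigma>\<bar> * L" using t by (intro mult_left_mono) auto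
    finally show "cmod (exp (twist_exponent A \<sigma> t)) \<le> exp (\<bar>\<sigma>\<bar> * L)"
      by (simp only: cmod_exp_twist exp_le_cancel_iff)
  qed
qed

lemma exp_minus_diff: "exp (- (a - b)) = exp (- a) * exp (b :: complex)"
  unfolding exp_add[symmetric] by simp

text \<open>Here \<open>\<i>\<close> times the last factor is \<open>e\<^bsup>-\<sigma>t\<^esup> y(t)\<close>, an absolutely continuous function.\<close>

lemma kernel_op_res_kernel:
  assumes A: "A \<in> borel_measurable (lebesgue_on {0..L})" and f: "f \<in> L2 (lebesgue_on {0..L})"
  shows "kernel_op (lebesgue_on {0..L}) (res_kernel L A \<sigma>) f t
    = \<i> * exp (- twist_exponent A \<sigma> t)
        * (bc_coeff L A \<sigma> * (LINT s|lebesgue_on {0..L}. exp (twist_exponent A \<sigma> s) * f s)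
           + primitive (lebesgue_on {0..L}) (\<lambda>s. exp (twist_exponent A \<sigma> s) * f s) t)"
proof -
  let ?M = "lebesgue_on {0..L}"
  interpret atomless_real_measure ?M
    by (rule atomless_real_measure_lebesgue_on)
  let ?f = "\<lambda>s. exp (twist_exponent A \<sigma> s) * f s"
  have int: "integrable ?M ?f"
    by (rule L2_mult_integrable[OF exp_twist_L2[OF A] f])
  have "kernel_op ?M (res_kernel L A \<sigma>) f t
      = (LINT s|?M. \<i> * exp (- twist_exponent A \<sigma> t) * (bc_coeff L A \<sigma> * ?f s + (if s \<le> t then ?f s else 0)))"
    unfolding kernel_op_def res_kernel_def exp_minus_diff
    by (intro Bochner_Integration.integral_cong) (simp_all add: distrib_left distrib_right mult_ac)
  also have "\<dots> = \<i> * exp (- twist_exponent A \<sigma> t) * (LINT s|?M. bc_coeff L A \<sigma> * ?f s + (if s \<le> t then ?f s else 0))"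
    by simp
  also have "(LINT s|?M. bc_coeff L A \<sigma> * ?f s + (if s \<le> t then ?f s else 0))
      = bc_coeff L A \<sigma> * (LINT s|?M. ?f s) + primitive ?M ?f t"
    unfolding primitive_def using int integrable_truncate[OF int, of t] by simp
  finally show ?thesis .
qed

lemma R_op_eq_kernel_op:
  assumes A: "A \<in> borel_measurable (lebesgue_on {0..L})" and f: "f \<in> L2 (lebesgue_on {0..L})"
    and t: "t \<in> {0..L}"
  shows "R_op L A f t = kernel_op (lebesgue_on {0..L}) (res_kernel L A 1) f t"
proof -
  let ?M = "lebesgue_on {0..L}"
  have \<Phi>: "\<Phi> A = twist_exponent A 1" by (simp add: fun_eq_iff \<Phi>_def twist_exponent_def)
  have 1: "(LINT s:{0..L}|lebesgue. h s) = (LINT s|?M. h s)" for h :: "real \<Rightarrow> complex"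
    by (simp add: set_lebesgue_integral_def integral_restrict_space)
  have "(LINT s:{0..t}|lebesgue. exp (- (\<Phi> A t - \<Phi> A s)) * f s)
      = primitive ?M (\<lambda>s. exp (- \<Phi> A t) * (exp (\<Phi> A s) * f s)) t"
    by (simp only: primitive_lebesgue_on[OF t] exp_minus_diff mult.assoc)
  also have "\<dots> = exp (- \<Phi> A t) * primitive ?M (\<lambda>s. exp (\<Phi> A s) * f s) t"
    by (rule atomless_real_measure.primitive_cmult[OF atomless_real_measure_lebesgue_on])
  finally show ?thesis
    unfolding kernel_op_res_kernel[OF A f] R_op_def 1 by (simp add: \<Phi> bc_coeff_def algebra_simps)
qed

lemma T_graph_eq:
  assumes "A \<in> borel_measurable (lebesgue_on {0..L})"
  shows "T_graph L A = resolvent_graph (lebesgue_on {0..L}) (kernel_op (lebesgue_on {0..L}) (res_kernel L A 1))"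
proof -
  have "(AE t in lebesgue_on {0..L}. u t = R_op L A f t) \<longleftrightarrow>
        (AE t in lebesgue_on {0..L}. u t = kernel_op (lebesgue_on {0..L}) (res_kernel L A 1) f t)"
    if "f \<in> L2 (lebesgue_on {0..L})" for u f
    by (rule AE_cong) (simp add: R_op_eq_kernel_op[OF assms that])
  then show ?thesis
    unfolding T_graph_def resolvent_graph_def by auto
qed

section \<open>Symmetry of the boundary value problem\<close>

text \<open>With \<open>y\<^sub>f = e\<^bsup>iA\<^esup> S\<^sub>\<sigma> f\<close> and \<open>y\<^sub>g = e\<^bsup>iA\<^esup> S\<^sub>\<tau> g\<close>, the left-hand side is the integral of the derivative of
  \<open>y\<^sub>f\<close> times the conjugate of \<open>y\<^sub>g\<close>. This product is periodic, as both factors are multiplied by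
  \<open>e\<^bsup>iA(L)\<^esup>\<close> between \<open>0\<close> and \<open>L\<close>. In the proof it is written as \<open>e\<^bsup>(\<sigma>+\<tau>)t\<^esup> F(t) G(t)\<close>, where \<open>F\<close> and
  \<open>G\<close> are plain primitives, and the product rule is applied twice.\<close>

lemma Green_identity:
  assumes L: "L > 0" and \<sigma>: "\<sigma> \<noteq> 0" and \<tau>: "\<tau> \<noteq> 0"
    and A: "A \<in> borel_measurable (lebesgue_on {0..L})"
    and f: "f \<in> L2 (lebesgue_on {0..L})" and g: "g \<in> L2 (lebesgue_on {0..L})"
  defines "M \<equiv> lebesgue_on {0..L}"
  defines "S \<equiv> \<lambda>\<sigma>. kernel_op M (res_kernel L A \<sigma>)"
  shows "\<i> * L2_inner M f (S \<tau> g) - \<i> * L2_inner M (S \<sigma> f) g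
           + of_real (\<sigma> + \<tau>) * L2_inner M (S \<sigma> f) (S \<tau> g) = 0"
proof -
  interpret atomless_real_measure M
    unfolding M_def by (rule atomless_real_measure_lebesgue_on)
  have space: "space M = {0..L}" by (simp add: M_def)
  have at_L: "primitive M h L = (LINT s|M. h s)" for h
    unfolding primitive_def by (intro Bochner_Integration.integral_cong) (auto simp: space)
  let ?e = "\<lambda>\<sigma> t. exp (twist_exponent A \<sigma> t)"
  let ?k = "complex_of_real (\<sigma> + \<tau>)"
  define f1 where "f1 s = ?e \<sigma> s * f s" for s
  define g1 where "g1 s = cnj (?e \<tau> s * g s)" for s
  define a where "a = bc_coeff L A \<sigma> * (LINT s|M. f1 s)"
  define b where "b = cnj (bc_coeff L A \<tau>) * (LINT s|M. g1 s)"
  define F where "F t = a + primitive M f1 t" for t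
  define G where "G t = b + primitive M g1 t" for t
  have f1: "integrable M f1" unfolding f1_def M_def
    by (rule L2_mult_integrable[OF exp_twist_L2[OF A] f])
  have g1: "integrable M g1" unfolding g1_def M_def
    by (intro integrable_cnj L2_mult_integrable[OF exp_twist_L2[OF A] g])
  have Sf: "S \<sigma> f t = \<i> * exp (- twist_exponent A \<sigma> t) * F t" for t
    unfolding S_def M_def kernel_op_res_kernel[OF A f] F_def a_def f1_def by simp
  have "primitive M g1 t = cnj (primitive M (\<lambda>s. ?e \<tau> s * g s) t)" for t
    unfolding primitive_def Bochner_Integration.integral_cnj[symmetric] g1_def
    by (intro Bochner_Integration.integral_cong) auto
  then have Sg: "cnj (S \<tau> g t) = - \<i> * cnj (exp (- twist_exponent A \<tau> t)) * G t" for t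
    unfolding S_def M_def kernel_op_res_kernel[OF A g] G_def b_def g1_def
    by (simp add: Bochner_Integration.integral_cnj del: complex_cnj_mult) simp
  define q where "q t = f1 t * G t + F t * g1 t" for t
  have q: "integrable M q"
    unfolding q_def by (rule primitive_product_rule(1)[OF f1 g1 F_def G_def])
  have FG: "F t * G t = a * b + primitive M q t" if "t \<in> space M" for t
    unfolding q_def by (rule primitive_product_rule(2)[OF f1 g1 F_def G_def that])
  have E': "integrable M (\<lambda>s. ?k * exp (?k * of_real s))"
    unfolding M_def by (intro continuous_imp_integrable_real continuous_intros)
  have E: "exp (?k * of_real t) = 1 + primitive M (\<lambda>s. ?k * exp (?k * of_real s)) t" if "t \<in> space M" for t
    using that primitive_exp[of t L ?k] by (simp add: M_def)
  define r where "r t = (?k * exp (?k * of_real t)) * (F t * G t) + exp (?k * of_real t) * q t" for t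
  have "exp (?k * of_real L) * (F L * G L) = 1 * (a * b) + primitive M r L"
    unfolding r_def using L by (intro primitive_product_rule(2)[OF E' q E FG]) (auto simp: space)
  \<comment> \<open>The boundary condition: \<open>F(0) = a\<close> and \<open>G(0) = b\<close>, and the three factors at \<open>L\<close> cancel.\<close>
  moreover have "exp (?k * of_real L) * (F L * G L) = a * b"
  proof -
    have bc: "bc_coeff L A \<rho> + 1 = ?e \<rho> L * bc_coeff L A \<rho>" if "\<rho> \<noteq> 0" for \<rho>
      using twist_boundary_neq_1[OF L that, of A] by (simp add: bc_coeff_def field_simps)
    have "F L = ?e \<sigma> L * a"
      unfolding F_def a_def at_L using bc[OF \<sigma>] by (metis distrib_right mult.assoc mult_1)
    moreover have "G L = cnj (?e \<tau> L) * b"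
    proof -
      have "G L = cnj (bc_coeff L A \<tau> + 1) * (LINT s|M. g1 s)"
        unfolding G_def b_def at_L by (simp add: distrib_right)
      then show ?thesis unfolding bc[OF \<tau>] b_def by simp
    qed
    moreover have "exp (?k * of_real L) * ?e \<sigma> L * cnj (?e \<tau> L) = 1"
      unfolding exp_cnj exp_add[symmetric] by (simp add: twist_exponent_def algebra_simps)
    ultimately show ?thesis by (metis mult.assoc mult.left_commute mult_1)
  qed
  ultimately have r0: "(LINT t|M. r t) = 0" by (simp add: at_L)
  have kb: "bounded_kernel M (kernel_bound L \<rho>) (res_kernel L A \<rho>)" if "\<rho> \<noteq> 0" for \<rho>
    unfolding M_def by (rule bounded_res_kernel[OF L that A])
  have fg: "f \<in> L2 M" "g \<in> L2 M" using f g by (auto simp: M_def)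
  have SL2: "S \<sigma> f \<in> L2 M" "S \<tau> g \<in> L2 M"
    unfolding S_def using kernel_op_L2[OF kb[OF \<sigma>] fg(1)] kernel_op_L2[OF kb[OF \<tau>] fg(2)] by auto
  \<comment> \<open>The derivative \<open>r\<close> of the product, expressed through \<open>f\<close>, \<open>g\<close> and the operators.\<close>
  have r_eq: "r t = \<i> * (f t * cnj (S \<tau> g t)) - \<i> * (S \<sigma> f t * cnj (g t))
      + ?k * (S \<sigma> f t * cnj (S \<tau> g t))" for t
  proof -
    have e1: "exp (- twist_exponent A \<sigma> t) * cnj (exp (- twist_exponent A \<tau> t)) = exp (?k * of_real t)"
      unfolding exp_cnj exp_add[symmetric] by (simp add: twist_exponent_def algebra_simps)
    have e2: "exp (?k * of_real t) * ?e \<sigma> t = cnj (exp (- twist_exponent A \<tau> t))"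
      unfolding exp_cnj exp_add[symmetric] by (simp add: twist_exponent_def algebra_simps)
    have e3: "exp (?k * of_real t) * cnj (?e \<tau> t) = exp (- twist_exponent A \<sigma> t)"
      unfolding exp_cnj exp_add[symmetric] by (simp add: twist_exponent_def algebra_simps)
    have "S \<sigma> f t * cnj (S \<tau> g t)
        = (exp (- twist_exponent A \<sigma> t) * cnj (exp (- twist_exponent A \<tau> t))) * (F t * G t)"
      unfolding Sf Sg by (simp add: algebra_simps)
    then have 1: "S \<sigma> f t * cnj (S \<tau> g t) = exp (?k * of_real t) * (F t * G t)"
      by (simp only: e1)
    have "exp (?k * of_real t) * (f1 t * G t) = (exp (?k * of_real t) * ?e \<sigma> t) * f t * G t"
      by (simp only: f1_def mult_ac)
    then have 2: "exp (?k * of_real t) * (f1 t * G t) = \<i> * (f t * cnj (S \<tau> g t))"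
      unfolding e2 Sg by (simp add: algebra_simps)
    have "exp (?k * of_real t) * (F t * g1 t) = (exp (?k * of_real t) * cnj (?e \<tau> t)) * F t * cnj (g t)"
      by (simp only: g1_def complex_cnj_mult mult_ac)
    then have 3: "exp (?k * of_real t) * (F t * g1 t) = - (\<i> * (S \<sigma> f t * cnj (g t)))"
      unfolding e3 Sf by (simp add: algebra_simps)
    have "r t = ?k * (exp (?k * of_real t) * (F t * G t)) + exp (?k * of_real t) * (f1 t * G t)
        + exp (?k * of_real t) * (F t * g1 t)"
      by (simp only: r_def q_def distrib_left mult.assoc add.assoc)
    then show ?thesis unfolding 1[symmetric] 2 3 by simp
  qed
  have "(LINT t|M. r t) = \<i> * L2_inner M f (S \<tau> g) - \<i> * L2_inner M (S \<sigma> f) g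
      + ?k * L2_inner M (S \<sigma> f) (S \<tau> g)"
    unfolding r_eq L2_inner_def
    using L2_inner_integrable[OF fg(1) SL2(2)] L2_inner_integrable[OF SL2(1) fg(2)]
      L2_inner_integrable[OF SL2]
    by (simp del: of_real_add)
  with r0 show ?thesis by simp
qed

lemma is_orth_proj_T_graph:
  assumes L: "L > 0" and A: "A \<in> borel_measurable (lebesgue_on {0..L})"
  shows "is_orth_proj (lebesgue_on {0..L}) (T_graph L A)
           (graph_proj (lebesgue_on {0..L}) (res_kernel L A 1) (res_kernel L A (- 1)))"
proof -
  interpret atomless_real_measure "lebesgue_on {0..L}"
    by (rule atomless_real_measure_lebesgue_on)
  show ?thesis
    unfolding T_graph_eq[OF A]
  proof (rule is_orth_proj_graph_proj)
    show "bounded_kernel (lebesgue_on {0..L}) (kernel_bound L 1) (res_kernel L A 1)"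
      "bounded_kernel (lebesgue_on {0..L}) (kernel_bound L (-1)) (res_kernel L A (-1))"
      by (intro bounded_res_kernel L A; simp)+
  next
    fix f g assume fg: "f \<in> L2 (lebesgue_on {0..L})" "g \<in> L2 (lebesgue_on {0..L})"
    show "L2_inner (lebesgue_on {0..L}) (kernel_op (lebesgue_on {0..L}) (res_kernel L A 1) f) g
        = L2_inner (lebesgue_on {0..L}) f (kernel_op (lebesgue_on {0..L}) (res_kernel L A (-1)) g)"
      using Green_identity[OF L _ _ A fg, of 1 "-1"] by simp
    show "2 * L2_inner (lebesgue_on {0..L}) (kernel_op (lebesgue_on {0..L}) (res_kernel L A 1) f)
            (kernel_op (lebesgue_on {0..L}) (res_kernel L A 1) g)
        = \<i> * L2_inner (lebesgue_on {0..L}) (kernel_op (lebesgue_on {0..L}) (res_kernel L A 1) f) g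
          - \<i> * L2_inner (lebesgue_on {0..L}) f (kernel_op (lebesgue_on {0..L}) (res_kernel L A 1) g)"
      using Green_identity[OF L _ _ A fg, of 1 1] by (simp add: algebra_simps add_eq_0_iff)
  qed
qed

theorem corollary1p5:
  fixes L :: real and An :: "nat \<Rightarrow> real \<Rightarrow> real" and A :: "real \<Rightarrow> real"
  assumes "L > 0"
    and "\<And>n. admissible L (An n)"
    and "admissible L A"
    and "very_weakly_converges L An A"
  shows "gap_converges (lebesgue_on {0..L}) (\<lambda>n. T_graph L (An n)) (T_graph L A)"
proof -
  interpret atomless_real_measure "lebesgue_on {0..L}"
    by (rule atomless_real_measure_lebesgue_on)
  note A = admissible_measurable[OF assms(3)]
  note An = admissible_measurable[OF assms(2)]
  define C where "C = max (kernel_bound L 1) (kernel_bound L (- 1))"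
  have kb: "bounded_kernel (lebesgue_on {0..L}) C (res_kernel L B \<sigma>)"
    if "\<sigma> \<in> {1, -1}" "B \<in> borel_measurable (lebesgue_on {0..L})" for B \<sigma>
  proof -
    have "kernel_bound L \<sigma> \<le> C" using that by (auto simp: C_def)
    then show ?thesis
      using bounded_res_kernel[OF assms(1) _ that(2), of \<sigma>] that(1)
      by (fastforce simp: bounded_kernel_def)
  qed
  show ?thesis
  proof (rule gap_converges_kernel[where C = C])
    show "is_orth_proj (lebesgue_on {0..L}) (T_graph L (An n))
        (graph_proj (lebesgue_on {0..L}) (res_kernel L (An n) 1) (res_kernel L (An n) (- 1)))" for n
      by (rule is_orth_proj_T_graph[OF assms(1) An])
    show "is_orth_proj (lebesgue_on {0..L}) (T_graph L A)
        (graph_proj (lebesgue_on {0..L}) (res_kernel L A 1) (res_kernel L A (- 1)))"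
      by (rule is_orth_proj_T_graph[OF assms(1) A])
  qed (rule kb[OF _ An] kb[OF _ A] res_kernel_tendsto_AE[OF assms(1) _ assms(4)]; simp)+
qed

end
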